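(* Let $D$ be an $n\times n$ irreducible doubly stochastic matrix, let $h:=h(D)$ and $n':=n/h$, and let $P$ be an $n\times n$ permutation matrix such that \[ P^{\intercal} D P = \left( D_1\oplus D_2\oplus\cdots\oplus D_h \right) \left( K_{h} \otimes I_{n'} \right), \] where each $D_i$, $1\leq i \leq h$, is an $n'\times n'$ doubly stochastic matrix. Then, for every $1\leq r \leq h$, \[ \lim_{m\to\infty} D^{mh+r} = P\left(K_{h}^r \otimes J_{n'} \right) P^{\intercal}. \]
   Context: A square matrix is doubly stochastic if its entries are nonnegative reals and each row and column sums to $1$. A square matrix $A$ is reducible if there is a permutation matrix $P$ such that $P^{\intercal}AP=\begin{bmatrix} A_1 & 0 \\ A_3 & A_2 \end{bmatrix}$ with $A_1,A_2$ square (nonempty) blocks; otherwise it is irreducible. For a square matrix $A$ with spectral radius $\rho(A)$, $h(A)$ is the number of eigenvalues of $A$ of modulus $\rho(A)$, counted with multiplicity; for doubly stochastic $D$ one has $\rho(D)=1$. It is a known fact (Marcus, Minc, Moyls) that for an irreducible doubly stochastic $n\times n$ matrix $D$, $h(D)$ divides $n$ and a permutation matrix $P$ and blocks $D_i$ as in the claim exist. $J_k$ is the $k\times k$ matrix with all entries $1/k$, $I_k$ is the $k\times k$ identity, $\oplus$ is the block-diagonal direct sum, and $A\otimes B$ is the Kronecker product, i.e. the block matrix with blocks $a_{ij}B$. $K_h$ is the $h\times h$ circular shift matrix, with entry $1$ in positions $(i,i+1)$ for $1\le i\le h-1$ and in position $(h,1)$, and $0$ elsewhere ($K_1=[1]$).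 *)

theory Defs
  imports "Jordan_Normal_Form.Spectral_Radius" "HOL-Combinatorics.Permutations"
begin

text \<open>Matrices are those of \<^theory>\<open>Jordan_Normal_Form.Matrix\<close>, so rows and columns are
  indexed from 0, whereas the usual matrix literature indexes them from 1.\<close>

definition doubly_stochastic :: "nat \<Rightarrow> real mat \<Rightarrow> bool" where
  "doubly_stochastic n D \<longleftrightarrow>
     D \<in> carrier_mat n n \<and>
     (\<forall>i<n. \<forall>j<n. 0 \<le> D $$ (i, j)) \<and>
     (\<forall>i<n. (\<Sum>j<n. D $$ (i, j)) = 1) \<and>
     (\<forall>j<n. (\<Sum>i<n. D $$ (i, j)) = 1)"

definition permutation_matrix :: "nat \<Rightarrow> 'a :: zero_neq_one mat \<Rightarrow> bool" where
  "permutation_matrix n P \<longleftrightarrow>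
     (\<exists>\<sigma>. \<sigma> permutes {..<n} \<and> P = mat n n (\<lambda>(i, j). if j = \<sigma> i then 1 else 0))"

definition reducible_mat :: "nat \<Rightarrow> 'a :: semiring_1 mat \<Rightarrow> bool" where
  "reducible_mat n A \<longleftrightarrow>
     A \<in> carrier_mat n n \<and>
     (\<exists>P k l A1 A2 A3.
        permutation_matrix n P \<and> 0 < k \<and> 0 < l \<and> k + l = n \<and>
        A1 \<in> carrier_mat k k \<and> A2 \<in> carrier_mat l l \<and> A3 \<in> carrier_mat l k \<and>
        transpose_mat P * A * P = four_block_mat A1 (0\<^sub>m k l) A3 A2)"

text \<open>With this definition every 1-by-1 matrix is irreducible, including the zero matrix.\<close>

definition irreducible_mat :: "nat \<Rightarrow> 'a :: semiring_1 mat \<Rightarrow> bool" where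
  "irreducible_mat n A \<longleftrightarrow> A \<in> carrier_mat n n \<and> \<not> reducible_mat n A"

text \<open>The number of eigenvalues of maximal modulus, each counted with its algebraic multiplicity.\<close>

definition peripheral_count :: "complex mat \<Rightarrow> nat" where
  "peripheral_count A =
     (\<Sum>\<mu> \<in> {\<mu> \<in> spectrum A. cmod \<mu> = spectral_radius A}. Polynomial.order \<mu> (char_poly A))"

definition kronecker_prod :: "'a :: times mat \<Rightarrow> 'a mat \<Rightarrow> 'a mat" (infixl "\<otimes>\<^sub>K" 70) where
  "A \<otimes>\<^sub>K B =
     mat (dim_row A * dim_row B) (dim_col A * dim_col B)
       (\<lambda>(i, j). A $$ (i div dim_row B, j div dim_col B) * B $$ (i mod dim_row B, j mod dim_col B))"

definition cyclic_shift_mat :: "nat \<Rightarrow> real mat" where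
  "cyclic_shift_mat h =
     mat h h (\<lambda>(i, j). if j = Suc i \<or> (Suc i = h \<and> j = 0) then 1 else 0)"

definition uniform_mat :: "nat \<Rightarrow> real mat" where
  "uniform_mat k = mat k k (\<lambda>_. 1 / real k)"

text \<open>The type of matrices carries no topology; convergence is entrywise, for matrices
  of one fixed size.\<close>

definition mat_tendsto :: "(nat \<Rightarrow> real mat) \<Rightarrow> real mat \<Rightarrow> bool" where
  "mat_tendsto X L \<longleftrightarrow>
     (\<forall>m. X m \<in> carrier_mat (dim_row L) (dim_col L)) \<and>
     (\<forall>i<dim_row L. \<forall>j<dim_col L. (\<lambda>m. X m $$ (i, j)) \<longlonglongrightarrow> L $$ (i, j))"

end

theory Submission
  imports Defs
begin

text \<open>Write \<open>K\<close>, \<open>J\<close> for the cyclic shift and the uniform matrix and put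
  \<open>L = P (K \<otimes> J) P\<^sup>T\<close>. Since the blocks are doubly stochastic, \<open>D L = L D = L L\<close>, so
  \<open>F = D - L\<close> satisfies \<open>F L = L F = 0\<close> and \<open>D\<^sup>m = F\<^sup>m + L\<^sup>m\<close> for \<open>m > 0\<close>, while \<open>L\<^sup>m\<close> is periodic
  in \<open>m\<close> with period \<open>h\<close>. It remains to see that \<open>F\<close> has spectral radius less than 1. From \<open>F L = 0\<close>
  one gets \<open>(x - F) (x - L) = x (x - D)\<close>, so away from 0 the eigenvalues of \<open>D\<close> are those of \<open>F\<close>
  together with those of \<open>L\<close>, with multiplicity. All \<open>h\<close>-th roots of unity are eigenvalues of \<open>L\<close>,
  and \<open>D\<close> has just \<open>h\<close> eigenvalues of modulus 1, so none is left for \<open>F\<close>.\<close>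

section \<open>Characteristic polynomials, spectral radius and matrix powers\<close>

text \<open>Expanding \<open>(x - A) (x - B)\<close> with \<open>A * B = 0\<close> leaves
  \<open>x (x - (A + B))\<close>; taking determinants turns the scalar factor \<open>x\<close> into
  \<open>x ^ n\<close>.\<close>

lemma char_poly_add_of_mult_zero:
  fixes A B :: "'a :: comm_ring_1 mat"
  assumes A: "A \<in> carrier_mat n n" and B: "B \<in> carrier_mat n n" and AB: "A * B = 0\<^sub>m n n"
  shows "[:0, 1:] ^ n * char_poly (A + B) = char_poly A * char_poly B"
proof -
  let ?c = "map_mat (\<lambda>a :: 'a. [:a:])" and ?X = "[:0, 1 :: 'a:] \<cdot>\<^sub>m 1\<^sub>m n"
  interpret c: comm_ring_hom "\<lambda>a :: 'a. [:a:]" by unfold_locales (auto simp: one_pCons)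
  have cp: "char_poly_matrix M = ?X - ?c M" if "M \<in> carrier_mat n n" for M
    using that unfolding char_poly_matrix_def by (intro eq_matI) auto
  have "?c (0\<^sub>m n n) = 0\<^sub>m n n" by (intro eq_matI) auto
  hence c0: "?c A * ?c B = 0\<^sub>m n n"
    using c.mat_hom_mult[OF A B] AB by simp
  have cA: "?c A \<in> carrier_mat n n" and cB: "?c B \<in> carrier_mat n n" using A B by auto
  have X: "?X \<in> carrier_mat n n" by auto
  have XM: "?X * M = [:0, 1:] \<cdot>\<^sub>m M" "M * ?X = [:0, 1:] \<cdot>\<^sub>m M" if "M \<in> carrier_mat n n" for M
    using that by (simp_all add: mult_smult_assoc_mat[of _ n n _ n] mult_smult_distrib[of _ n n _ n])
  have "char_poly_matrix A * char_poly_matrix B = ?X * (?X - ?c B) - ?c A * (?X - ?c B)"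
    unfolding cp[OF A] cp[OF B] using cA cB X by (intro minus_mult_distrib_mat) auto
  also have "\<dots> = ([:0, 1:] \<cdot>\<^sub>m ?X - [:0, 1:] \<cdot>\<^sub>m ?c B) - ([:0, 1:] \<cdot>\<^sub>m ?c A - 0\<^sub>m n n)"
    unfolding mult_minus_distrib_mat[OF X X cB] mult_minus_distrib_mat[OF cA X cB]
      XM(1)[OF X] XM(1)[OF cB] XM(2)[OF cA] c0 by (rule refl)
  also have "\<dots> = [:0, 1:] \<cdot>\<^sub>m char_poly_matrix (A + B)"
    unfolding cp[OF add_carrier_mat[OF B, of A]] using A B
    by (intro eq_matI) (auto simp: algebra_simps)
  finally have eq: "char_poly_matrix A * char_poly_matrix B = [:0, 1:] \<cdot>\<^sub>m char_poly_matrix (A + B)" .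
  have "dim_col (char_poly_matrix (A + B)) = n"
    using B by (simp add: char_poly_matrix_def)
  moreover have "det (char_poly_matrix A * char_poly_matrix B) = char_poly A * char_poly B"
    unfolding char_poly_def by (intro det_mult[of _ n]) (use A B in auto)
  ultimately show ?thesis unfolding eq by (simp add: char_poly_def)
qed

lemma pow_mat_smult:
  fixes A :: "'a :: comm_semiring_1 mat"
  assumes "A \<in> carrier_mat n n"
  shows "(c \<cdot>\<^sub>m A) ^\<^sub>m k = c ^ k \<cdot>\<^sub>m A ^\<^sub>m k"
proof (induction k)
  case 0
  show ?case using assms by (auto intro!: eq_matI)
next
  case (Suc k)
  have "(c \<cdot>\<^sub>m A) ^\<^sub>m Suc k = (c ^ k \<cdot>\<^sub>m A ^\<^sub>m k) * (c \<cdot>\<^sub>m A)" using Suc by simp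
  also have "\<dots> = c ^ k \<cdot>\<^sub>m (A ^\<^sub>m k * (c \<cdot>\<^sub>m A))"
    by (rule mult_smult_assoc_mat) (use assms in auto)
  also have "A ^\<^sub>m k * (c \<cdot>\<^sub>m A) = c \<cdot>\<^sub>m (A ^\<^sub>m k * A)"
    by (rule mult_smult_distrib) (use assms in auto)
  also have "c ^ k \<cdot>\<^sub>m (c \<cdot>\<^sub>m (A ^\<^sub>m k * A)) = c ^ Suc k \<cdot>\<^sub>m A ^\<^sub>m Suc k"
    by (intro eq_matI) (auto simp: mult_ac)
  finally show ?case .
qed

lemma eigenvalue_smult:
  fixes A :: "'a :: field mat"
  assumes "A \<in> carrier_mat n n" "c \<noteq> 0" "eigenvalue (c \<cdot>\<^sub>m A) k"
  shows "eigenvalue A (k / c)"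
proof -
  obtain v where v: "v \<in> carrier_vec n" "v \<noteq> 0\<^sub>v n" "(c \<cdot>\<^sub>m A) *\<^sub>v v = k \<cdot>\<^sub>v v"
    using assms unfolding eigenvalue_def eigenvector_def by auto
  have "c \<cdot>\<^sub>v (A *\<^sub>v v) = k \<cdot>\<^sub>v v"
    unfolding v(3)[symmetric] using v(1) assms(1) by (intro eq_vecI) auto
  hence "(1 / c) \<cdot>\<^sub>v (c \<cdot>\<^sub>v (A *\<^sub>v v)) = (1 / c) \<cdot>\<^sub>v (k \<cdot>\<^sub>v v)" by simp
  hence "A *\<^sub>v v = (k / c) \<cdot>\<^sub>v v" using assms(2) by (simp add: smult_smult_assoc)
  with v assms(1) show ?thesis unfolding eigenvalue_def eigenvector_def by auto
qed

text \<open>Rescaling gives geometric decay: for \<open>c\<close> strictly between the spectral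
  radius and 1, \<open>B = A / c\<close> still has spectral radius below 1, so its powers are
  bounded, and the \<open>m\<close>-th power of \<open>A\<close> is \<open>c ^ m\<close> times a
  bounded matrix.\<close>

lemma pow_mat_entry_tendsto_0:
  fixes A :: "complex mat"
  assumes A: "A \<in> carrier_mat n n" and "n > 0" and sr: "spectral_radius A < 1"
    and ij: "i < n" "j < n"
  shows "(\<lambda>m. (A ^\<^sub>m m) $$ (i, j)) \<longlonglongrightarrow> 0"
proof -
  have sr0: "spectral_radius A \<ge> 0" using spectral_radius_mem_max(1)[OF A \<open>n > 0\<close>] by auto
  obtain c where c: "spectral_radius A < c" "c < 1" using dense[OF sr] by auto
  hence "c > 0" using sr0 by auto
  define B where "B = inverse (complex_of_real c) \<cdot>\<^sub>m A"
  have B: "B \<in> carrier_mat n n" using A by (auto simp: B_def)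
  have "cmod \<mu> < 1" if "\<mu> \<in> spectrum B" for \<mu>
  proof -
    have "eigenvalue A (\<mu> / inverse (complex_of_real c))"
      using that \<open>c > 0\<close> A unfolding spectrum_def B_def by (intro eigenvalue_smult) auto
    hence "cmod (\<mu> / inverse (complex_of_real c)) \<le> spectral_radius A"
      by (intro spectral_radius_mem_max(2)[OF A \<open>n > 0\<close>]) (auto simp: spectrum_def)
    hence "cmod \<mu> * c \<le> spectral_radius A"
      using \<open>c > 0\<close> by (simp add: divide_inverse norm_mult)
    hence "cmod \<mu> * c < 1 * c" using c by linarith
    thus ?thesis using \<open>c > 0\<close> by (simp only: mult_less_cancel_right_pos)
  qed
  hence "spectral_radius B < 1" using spectral_radius_mem_max(1)[OF B \<open>n > 0\<close>] by auto
  then obtain b where b: "norm_bound (B ^\<^sub>m k) b" for k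
    using spectral_radius_jnf_norm_bound_less_1_upper_triangular[OF B] by blast
  have "A = complex_of_real c \<cdot>\<^sub>m B"
    using \<open>c > 0\<close> by (intro eq_matI) (auto simp: B_def)
  hence Am: "A ^\<^sub>m m = complex_of_real c ^ m \<cdot>\<^sub>m B ^\<^sub>m m" for m
    using pow_mat_smult[OF B] by simp
  have le: "cmod ((A ^\<^sub>m m) $$ (i, j)) \<le> c ^ m * b" for m
    using b[of m] ij B \<open>c > 0\<close> unfolding Am norm_bound_def
    by (auto simp: norm_mult norm_power intro!: mult_left_mono)
  have "(\<lambda>m. c ^ m) \<longlonglongrightarrow> 0"
    using \<open>c > 0\<close> \<open>c < 1\<close> by (intro LIMSEQ_realpow_zero) auto
  thus ?thesis
  proof (rule tendsto_0_le)
    show "\<forall>\<^sub>F m in sequentially. cmod ((A ^\<^sub>m m) $$ (i, j)) \<le> norm (c ^ m) * b"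
      using le \<open>c > 0\<close> by (simp add: norm_power)
  qed
qed

text \<open>Multiplicities are counted on the unit circle. Those of \<open>A\<close> are the sums of
  those of \<open>A - L\<close> and of \<open>L\<close>, and \<open>L\<close> alone already uses up
  \<open>card S\<close>, the most that \<open>A\<close> can have.\<close>

lemma spectral_radius_deflate:
  fixes A L :: "complex mat"
  assumes A: "A \<in> carrier_mat n n" and L: "L \<in> carrier_mat n n" and "n > 0"
    and AL: "A * L = L * L"
    and le1: "\<And>\<mu>. eigenvalue A \<mu> \<Longrightarrow> cmod \<mu> \<le> 1"
    and S: "finite S" "S \<noteq> {}" "\<And>\<mu>. \<mu> \<in> S \<Longrightarrow> eigenvalue L \<mu> \<and> cmod \<mu> = 1"
    and count: "peripheral_count A \<le> card S"
  shows "spectral_radius (A - L) < 1"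
proof -
  define F where "F = A - L"
  have F: "F \<in> carrier_mat n n" unfolding F_def by (rule minus_carrier_mat[OF L])
  have FL: "F * L = 0\<^sub>m n n" unfolding F_def
    using A L AL by (subst minus_mult_distrib_mat[of _ n n _ _ n]) auto
  have "F + L = A" unfolding F_def using A L by (intro eq_matI) auto
  hence cp: "[:0, 1:] ^ n * char_poly A = char_poly F * char_poly L"
    using char_poly_add_of_mult_zero[OF F L FL] by simp
  have nz: "char_poly M \<noteq> 0" if "M \<in> carrier_mat n n" for M :: "complex mat"
    using degree_monic_char_poly[OF that] by auto
  \<comment> \<open>The factor \<open>x ^ n\<close> changes root multiplicities only at 0, so they
    can be compared at every other point.\<close>
  have ord0: "order \<mu> ([:0, 1:] ^ n :: complex poly) = 0" if "\<mu> \<noteq> 0" for \<mu>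
    using that by (intro order_0I) simp
  have ord: "order \<mu> (char_poly A) = order \<mu> (char_poly F) + order \<mu> (char_poly L)"
    if "\<mu> \<noteq> 0" for \<mu>
  proof -
    have "order \<mu> ([:0, 1:] ^ n * char_poly A) = order \<mu> (char_poly A)"
      by (subst order_mult) (use nz[OF A] ord0[OF that] in auto)
    moreover have "order \<mu> (char_poly F * char_poly L) = order \<mu> (char_poly F) + order \<mu> (char_poly L)"
      by (rule order_mult) (use nz[OF F] nz[OF L] in auto)
    ultimately show ?thesis using cp by simp
  qed
  have ev: "eigenvalue M \<mu> \<longleftrightarrow> order \<mu> (char_poly M) \<noteq> 0" if "M \<in> carrier_mat n n"
    for M :: "complex mat" and \<mu>
    using eigenvalue_root_char_poly[OF that] order_root nz[OF that] by blast
  have evA: "eigenvalue A \<mu>" if "eigenvalue F \<mu> \<or> eigenvalue L \<mu>" "\<mu> \<noteq> 0" for \<mu>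
    using that ord[of \<mu>] ev[OF A] ev[OF F] ev[OF L] by auto
  have fin: "finite (spectrum A)" by (rule card_finite_spectrum(1)[OF A])
  have SA: "\<mu> \<in> spectrum A" if "\<mu> \<in> S" for \<mu>
  proof -
    have "\<mu> \<noteq> 0" using S(3)[OF that] by auto
    thus ?thesis using evA[of \<mu>] S(3)[OF that] by (auto simp: spectrum_def)
  qed
  \<comment> \<open>\<open>peripheral_count\<close> measures moduli against the spectral radius;
    this value lets the unit circle take its place in \<open>T\<close>.\<close>
  have srA: "spectral_radius A = 1"
  proof (rule antisym)
    show "spectral_radius A \<le> 1"
      using spectral_radius_mem_max(1)[OF A \<open>n > 0\<close>] le1 by (auto simp: spectrum_def)
    obtain \<mu> where "\<mu> \<in> S" using S by auto
    thus "1 \<le> spectral_radius A"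
      using spectral_radius_mem_max(2)[OF A \<open>n > 0\<close>, of "cmod \<mu>"] SA S(3) by force
  qed
  define T where "T = {\<mu> \<in> spectrum A. cmod \<mu> = 1}"
  have T: "finite T" "S \<subseteq> T" "\<And>\<mu>. \<mu> \<in> T \<Longrightarrow> \<mu> \<noteq> 0"
    using fin SA S(3) by (auto simp: T_def)
  have "card S = (\<Sum>\<mu>\<in>S. 1)" by simp
  also have "\<dots> \<le> (\<Sum>\<mu>\<in>S. order \<mu> (char_poly L))"
    using S(3) ev[OF L] by (intro sum_mono) force
  also have "\<dots> \<le> (\<Sum>\<mu>\<in>T. order \<mu> (char_poly L))" using T by (intro sum_mono2) auto
  finally have cS: "card S \<le> (\<Sum>\<mu>\<in>T. order \<mu> (char_poly L))" .
  have "peripheral_count A = (\<Sum>\<mu>\<in>T. order \<mu> (char_poly A))"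
    by (simp add: peripheral_count_def srA T_def)
  also have "\<dots> = (\<Sum>\<mu>\<in>T. order \<mu> (char_poly F)) + (\<Sum>\<mu>\<in>T. order \<mu> (char_poly L))"
    using T ord by (simp add: sum.distrib)
  \<comment> \<open>The total is at most \<open>card S\<close> by \<open>count\<close>, and the
    share of \<open>L\<close> is at least \<open>card S\<close> by \<open>cS\<close>, so nothing is
    left for \<open>F\<close>.\<close>
  finally have "(\<Sum>\<mu>\<in>T. order \<mu> (char_poly F)) = 0" using cS count by simp
  hence no: "\<not> eigenvalue F \<mu>" if "\<mu> \<in> T" for \<mu> using that T(1) ev[OF F] by simp
  \<comment> \<open>An eigenvalue of \<open>F\<close> of modulus at least 1 is nonzero, hence an
    eigenvalue of \<open>A\<close>, hence on the unit circle by \<open>le1\<close> and so in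
    \<open>T\<close>, where \<open>F\<close> has none.\<close>
  have "cmod \<mu> < 1" if "eigenvalue F \<mu>" for \<mu>
  proof (rule ccontr)
    assume "\<not> cmod \<mu> < 1"
    moreover from this have "\<mu> \<noteq> 0" by auto
    hence "eigenvalue A \<mu>" using evA[of \<mu>] that by simp
    ultimately have "\<mu> \<in> T" using le1[of \<mu>] by (auto simp: T_def spectrum_def)
    thus False using no that by blast
  qed
  thus ?thesis unfolding F_def[symmetric]
    using spectral_radius_mem_max(1)[OF F \<open>n > 0\<close>] by (auto simp: spectrum_def)
qed

text \<open>With \<open>F = A - L\<close>, both \<open>F * L\<close> and \<open>L * F\<close>
  vanish, so no mixed term survives in a power of \<open>F + L\<close>. At exponent 0 the right-hand
  side would be twice the identity.\<close>

lemma pow_mat_deflate: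
  fixes A L :: "'a :: ring_1 mat"
  assumes A: "A \<in> carrier_mat n n" and L: "L \<in> carrier_mat n n"
    and AL: "A * L = L * L" and LA: "L * A = L * L" and "m > 0"
  shows "A ^\<^sub>m m = (A - L) ^\<^sub>m m + L ^\<^sub>m m"
  using \<open>m > 0\<close>
proof (induction m rule: nat_induct_non_zero)
  case 1
  show ?case using A L by (auto intro!: eq_matI)
next
  case (Suc m)
  have F: "A - L \<in> carrier_mat n n" by (rule minus_carrier_mat[OF L])
  have FL: "(A - L) * L = 0\<^sub>m n n"
    using A L AL by (subst minus_mult_distrib_mat[of _ n n _ _ n]) auto
  \<comment> \<open>Splitting one factor off the power brings \<open>A - L\<close> next to
    \<open>L\<close>, and \<open>L\<close> next to \<open>A\<close>, where \<open>FL\<close> and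
    \<open>LA\<close> apply.\<close>
  obtain k where m: "m = Suc k" using Suc.hyps gr0_implies_Suc by blast
  have "(A - L) ^\<^sub>m m * L = (A - L) ^\<^sub>m k * ((A - L) * L)"
    unfolding m pow_mat.simps(2) by (rule assoc_mult_mat[OF pow_carrier_mat[OF F] F L])
  also have "\<dots> = 0\<^sub>m n n" unfolding FL by (rule right_mult_zero_mat[OF pow_carrier_mat[OF F]])
  finally have FmL: "(A - L) ^\<^sub>m m * L = 0\<^sub>m n n" .
  have "L ^\<^sub>m m * A = L ^\<^sub>m k * (L * A)"
    unfolding m pow_mat.simps(2) by (rule assoc_mult_mat[OF pow_carrier_mat[OF L] L A])
  also have "\<dots> = L ^\<^sub>m m * L"
    unfolding m pow_mat.simps(2) LA by (rule assoc_mult_mat[OF pow_carrier_mat[OF L] L L, symmetric])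
  finally have LmA: "L ^\<^sub>m m * A = L ^\<^sub>m m * L" .
  have minus_zero: "X - 0\<^sub>m n n = X" if "X \<in> carrier_mat n n" for X :: "'a mat"
    using that by (intro eq_matI) auto
  have "(A - L) ^\<^sub>m m * (A - L) = (A - L) ^\<^sub>m m * A - 0\<^sub>m n n"
    unfolding FmL[symmetric] by (rule mult_minus_distrib_mat[OF pow_carrier_mat[OF F] A L])
  also have "\<dots> = (A - L) ^\<^sub>m m * A"
    by (rule minus_zero[OF mult_carrier_mat[OF pow_carrier_mat[OF F] A]])
  finally have FA: "(A - L) ^\<^sub>m m * (A - L) = (A - L) ^\<^sub>m m * A" .
  have "A ^\<^sub>m Suc m = ((A - L) ^\<^sub>m m + L ^\<^sub>m m) * A" using Suc.IH by simp
  also have "\<dots> = (A - L) ^\<^sub>m m * A + L ^\<^sub>m m * A"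
    by (rule add_mult_distrib_mat[OF pow_carrier_mat[OF F] pow_carrier_mat[OF L] A])
  finally show ?case using FA LmA by simp
qed

text \<open>At an entry of maximal modulus of an eigenvector \<open>v\<close>, the eigenvalue
  equation makes \<mu> times that entry a convex combination of the entries of \<open>v\<close>,
  whose modulus cannot exceed the maximum.\<close>

lemma row_stochastic_eigenvalue_le_1:
  fixes D :: "real mat"
  assumes D: "D \<in> carrier_mat n n"
    and nonneg: "\<And>i j. i < n \<Longrightarrow> j < n \<Longrightarrow> 0 \<le> D $$ (i, j)"
    and rows: "\<And>i. i < n \<Longrightarrow> (\<Sum>j<n. D $$ (i, j)) = 1"
    and ev: "eigenvalue (map_mat complex_of_real D) \<mu>"
  shows "cmod \<mu> \<le> 1"
proof -
  let ?A = "map_mat complex_of_real D"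
  obtain v where v: "v \<in> carrier_vec n" "v \<noteq> 0\<^sub>v n" "?A *\<^sub>v v = \<mu> \<cdot>\<^sub>v v"
    using ev D unfolding eigenvalue_def eigenvector_def by auto
  have "n > 0" using v by (cases n) auto
  define b where "b = Max ((\<lambda>i. cmod (v $ i)) ` {..<n})"
  have le: "cmod (v $ i) \<le> b" if "i < n" for i using that by (auto simp: b_def)
  obtain i where i: "i < n" "cmod (v $ i) = b"
    using Max_in[of "(\<lambda>i. cmod (v $ i)) ` {..<n}"] \<open>n > 0\<close> by (fastforce simp: b_def)
  \<comment> \<open>An eigenvector has a nonzero entry, so the maximum \<open>b\<close> is positive
    and can be cancelled at the end.\<close>
  obtain k where k: "k < n" "v $ k \<noteq> 0" using v(1,2) by (metis carrier_vecD eq_vecI index_zero_vec)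
  have "b > 0" using le[OF k(1)] k(2) by (meson less_le_trans zero_less_norm_iff)
  have "\<mu> * v $ i = (?A *\<^sub>v v) $ i" using v i by simp
  also have "\<dots> = (\<Sum>j<n. of_real (D $$ (i, j)) * v $ j)"
    using D v(1) i(1) by (auto simp: scalar_prod_def lessThan_atLeast0 intro!: sum.cong)
  finally have "cmod \<mu> * b = cmod (\<Sum>j<n. of_real (D $$ (i, j)) * v $ j)"
    using i by (metis norm_mult)
  also have "\<dots> \<le> (\<Sum>j<n. D $$ (i, j) * b)"
    using i nonneg le by (intro sum_norm_le) (auto simp: norm_mult intro!: mult_mono)
  also have "\<dots> = b" using rows[OF i(1)] by (simp flip: sum_distrib_right)
  finally show ?thesis using \<open>b > 0\<close> by simp
qed

section \<open>Block indices and Kronecker products\<close>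

text \<open>Splitting an index into block number \<open>i\<close> and offset \<open>j\<close> is the
  basis of all entrywise computations with Kronecker and block-diagonal products below.\<close>

lemma sum_lessThan_mult:
  fixes f :: "nat \<Rightarrow> 'a :: comm_monoid_add"
  shows "(\<Sum>k<a * b. f k) = (\<Sum>i<a. \<Sum>j<b. f (i * b + j))"
proof -
  have "sum f {i * b..<i * b + b} = (\<Sum>j<b. f (i * b + j))" for i
    using sum.shift_bounds_nat_ivl[of f 0 "i * b" b] by (simp add: lessThan_atLeast0 add.commute)
  thus ?thesis by (simp flip: sum.nat_group)
qed

lemma div_less_of_less_mult: "i div b < a" if "i < a * b" for i a b :: nat
  using that by (simp add: less_mult_imp_div_less)

lemma block_index_less: "i * b + j < a * b" if "i < a" "j < b" for i j a b :: nat
proof -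
  have "i * b + j < Suc i * b" using that by simp
  also have "\<dots> \<le> a * b" using that by (intro mult_right_mono) auto
  finally show ?thesis .
qed

lemma index_mult_mat_sum:
  assumes "A \<in> carrier_mat n p" "B \<in> carrier_mat p q" "i < n" "j < q"
  shows "(A * B) $$ (i, j) = (\<Sum>k<p. A $$ (i, k) * B $$ (k, j))"
  using assms by (auto simp: scalar_prod_def lessThan_atLeast0 intro!: sum.cong)

lemma kronecker_prod_carrier [simp]:
  "A \<in> carrier_mat n p \<Longrightarrow> B \<in> carrier_mat q r \<Longrightarrow> A \<otimes>\<^sub>K B \<in> carrier_mat (n * q) (p * r)"
  by (auto simp: kronecker_prod_def)

lemma index_kronecker_prod:
  assumes "A \<in> carrier_mat n p" "B \<in> carrier_mat q r" "i < n * q" "j < p * r"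
  shows "(A \<otimes>\<^sub>K B) $$ (i, j) = A $$ (i div q, j div r) * B $$ (i mod q, j mod r)"
  using assms by (auto simp: kronecker_prod_def)

text \<open>The mixed-product rule: once the summation index is split, each summand separates into a
  factor for the block number and one for the offset, so the double sum is a product of two
  sums.\<close>

lemma kronecker_prod_mult:
  fixes A :: "'a :: comm_semiring_0 mat"
  assumes A: "A \<in> carrier_mat n p" and B: "B \<in> carrier_mat q r"
    and C: "C \<in> carrier_mat p s" and D: "D \<in> carrier_mat r t"
  shows "(A \<otimes>\<^sub>K B) * (C \<otimes>\<^sub>K D) = (A * C) \<otimes>\<^sub>K (B * D)"
proof (rule eq_matI)
  show "dim_row ((A \<otimes>\<^sub>K B) * (C \<otimes>\<^sub>K D)) = dim_row ((A * C) \<otimes>\<^sub>K (B * D))"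
    "dim_col ((A \<otimes>\<^sub>K B) * (C \<otimes>\<^sub>K D)) = dim_col ((A * C) \<otimes>\<^sub>K (B * D))"
    by (auto simp: kronecker_prod_def)
next
  fix i j assume "i < dim_row ((A * C) \<otimes>\<^sub>K (B * D))" "j < dim_col ((A * C) \<otimes>\<^sub>K (B * D))"
  hence ij: "i < n * q" "j < s * t" using A B C D by (auto simp: kronecker_prod_def)
  hence "q > 0" "t > 0" by (auto intro: Nat.gr0I)
  hence dm: "i div q < n" "j div t < s" "i mod q < q" "j mod t < t"
    using ij by (auto simp: div_less_of_less_mult)
  have "((A \<otimes>\<^sub>K B) * (C \<otimes>\<^sub>K D)) $$ (i, j)
      = (\<Sum>k<p * r. (A \<otimes>\<^sub>K B) $$ (i, k) * (C \<otimes>\<^sub>K D) $$ (k, j))"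
    using A B C D ij by (intro index_mult_mat_sum) auto
  also have "\<dots> = (\<Sum>k<p. \<Sum>l<r. (A $$ (i div q, k) * C $$ (k, j div t))
      * (B $$ (i mod q, l) * D $$ (l, j mod t)))"
    unfolding sum_lessThan_mult
    by (intro sum.cong refl)
      (use A B C D ij in \<open>auto simp: index_kronecker_prod block_index_less mult_ac\<close>)
  also have "\<dots> = (A * C) $$ (i div q, j div t) * (B * D) $$ (i mod q, j mod t)"
    by (simp add: index_mult_mat_sum[OF A C dm(1,2)] index_mult_mat_sum[OF B D dm(3,4)] sum_product)
  also have "\<dots> = ((A * C) \<otimes>\<^sub>K (B * D)) $$ (i, j)"
    by (rule index_kronecker_prod[symmetric]) (use A B C D ij in auto)
  finally show "((A \<otimes>\<^sub>K B) * (C \<otimes>\<^sub>K D)) $$ (i, j) = ((A * C) \<otimes>\<^sub>K (B * D)) $$ (i, j)" .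
qed

text \<open>The mixed-product rule multiplies the first factors, while idempotence keeps the second
  one fixed. Exponent 0 would give the identity on the left, but \<open>B\<close> as second factor
  on the right.\<close>

lemma kronecker_prod_pow:
  fixes A B :: "'a :: comm_semiring_1 mat"
  assumes A: "A \<in> carrier_mat n n" and B: "B \<in> carrier_mat q q" and idem: "B * B = B" and "m > 0"
  shows "(A \<otimes>\<^sub>K B) ^\<^sub>m m = (A ^\<^sub>m m) \<otimes>\<^sub>K B"
  using \<open>m > 0\<close>
proof (induction m rule: nat_induct_non_zero)
  case 1
  show ?case using A B kronecker_prod_carrier[OF A B] by simp
next
  case (Suc m)
  then show ?case using kronecker_prod_mult[OF pow_carrier_mat[OF A] B A B] idem by simp
qed

section \<open>Block-diagonal and uniform matrices\<close>

lemma diag_block_mat_uniform_carrier: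
  assumes "\<And>A. A \<in> set As \<Longrightarrow> A \<in> carrier_mat k k"
  shows "diag_block_mat As \<in> carrier_mat (length As * k) (length As * k)"
  using assms by (induction As) (auto simp: Let_def)

lemma index_diag_block_mat_uniform:
  assumes "\<And>A. A \<in> set As \<Longrightarrow> A \<in> carrier_mat k k"
    and "i < length As * k" "j < length As * k"
  shows "diag_block_mat As $$ (i, j) = (if i div k = j div k then (As ! (i div k)) $$ (i mod k, j mod k) else 0)"
  using assms
proof (induction As arbitrary: i j)
  case (Cons A As)
  have D: "diag_block_mat As \<in> carrier_mat (length As * k) (length As * k)"
    by (rule diag_block_mat_uniform_carrier) (use Cons.prems in auto)
  have A: "A \<in> carrier_mat k k" using Cons.prems by auto
  have "k > 0" using Cons.prems by (auto intro: Nat.gr0I)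
  \<comment> \<open>Past the first block both indices drop by \<open>k\<close>: block numbers fall
    by one and offsets stay the same.\<close>
  have IH: "diag_block_mat As $$ (i - k, j - k) = (if (i - k) div k = (j - k) div k
      then (As ! ((i - k) div k)) $$ ((i - k) mod k, (j - k) mod k) else 0)"
    if "k \<le> i" "k \<le> j"
    using Cons that by (intro Cons.IH) auto
  show ?case
    using Cons.prems(2,3) \<open>k > 0\<close> IH carrier_matD[OF A] carrier_matD[OF D]
    by (cases "i < k"; cases "j < k") (auto simp: Let_def not_less le_div_geq le_mod_geq)
qed auto

lemma uniform_mat_carrier [simp]: "uniform_mat k \<in> carrier_mat k k"
  by (simp add: uniform_mat_def)

lemma uniform_mat_idem: "uniform_mat k * uniform_mat k = uniform_mat k"
  by (intro eq_matI) (auto simp: uniform_mat_def scalar_prod_def)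

text \<open>An entry of the Kronecker product depends only on block numbers, so the block-diagonal
  factor averages a constant over one block. The weights are a row of a block when it stands on the
  left, a column when on the right, and sum to 1.\<close>

lemma diag_block_mult_kronecker_uniform:
  assumes len: "length As = h"
    and As: "\<And>A. A \<in> set As \<Longrightarrow> doubly_stochastic k A"
    and X: "X \<in> carrier_mat h h"
  shows "diag_block_mat As * (X \<otimes>\<^sub>K uniform_mat k) = X \<otimes>\<^sub>K uniform_mat k"
    and "(X \<otimes>\<^sub>K uniform_mat k) * diag_block_mat As = X \<otimes>\<^sub>K uniform_mat k"
proof -
  have c: "A \<in> carrier_mat k k" if "A \<in> set As" for A
    using As[OF that] by (simp add: doubly_stochastic_def)
  have D: "diag_block_mat As \<in> carrier_mat (h * k) (h * k)"
    using diag_block_mat_uniform_carrier[of As k] c len by simp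
  have XU: "X \<otimes>\<^sub>K uniform_mat k \<in> carrier_mat (h * k) (h * k)" using X by simp
  have rows: "(\<Sum>b<k. (As ! a) $$ (i, b)) = 1" and cols: "(\<Sum>b<k. (As ! a) $$ (b, i)) = 1"
    if "a < h" "i < k" for a i
    using As[of "As ! a"] that len by (auto simp: doubly_stochastic_def)
  have idx: "(X \<otimes>\<^sub>K uniform_mat k) $$ (i, j) = X $$ (i div k, j div k) / k"
    if "i < h * k" "j < h * k" for i j
    using that index_kronecker_prod[OF X uniform_mat_carrier that]
    by (cases "k = 0") (auto simp: uniform_mat_def)
  have idxD: "diag_block_mat As $$ (i, j) =
      (if i div k = j div k then (As ! (i div k)) $$ (i mod k, j mod k) else 0)"
    if "i < h * k" "j < h * k" for i j
    using that index_diag_block_mat_uniform[of As k i j] c len by simp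
  {
    fix i j assume ij: "i < h * k" "j < h * k"
    hence "k > 0" by (auto intro: Nat.gr0I)
    hence dm: "i div k < h" "j div k < h" "i mod k < k" "j mod k < k"
      using ij by (auto simp: div_less_of_less_mult)
    have "(diag_block_mat As * (X \<otimes>\<^sub>K uniform_mat k)) $$ (i, j) =
        (\<Sum>a<h. \<Sum>b<k. (if i div k = a then (As ! a) $$ (i mod k, b) * (X $$ (a, j div k) / k) else 0))"
      unfolding index_mult_mat_sum[OF D XU ij] sum_lessThan_mult
      by (intro sum.cong refl)
        (use ij in \<open>auto simp: idxD idx block_index_less\<close>)
    also have "\<dots> = (\<Sum>a<h. if i div k = a then X $$ (a, j div k) / k else 0)"
      using rows dm by (intro sum.cong refl) (auto simp flip: sum_distrib_right sum_divide_distrib)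
    also have "\<dots> = (X \<otimes>\<^sub>K uniform_mat k) $$ (i, j)" using dm idx[OF ij] by simp
    finally have "(diag_block_mat As * (X \<otimes>\<^sub>K uniform_mat k)) $$ (i, j) = (X \<otimes>\<^sub>K uniform_mat k) $$ (i, j)" .
    note 1 = this
    have "((X \<otimes>\<^sub>K uniform_mat k) * diag_block_mat As) $$ (i, j) =
        (\<Sum>a<h. \<Sum>b<k. (if a = j div k then (X $$ (i div k, a) / k) * (As ! a) $$ (b, j mod k) else 0))"
      unfolding index_mult_mat_sum[OF XU D ij] sum_lessThan_mult
      by (intro sum.cong refl)
        (use ij in \<open>auto simp: idxD idx block_index_less\<close>)
    also have "\<dots> = (\<Sum>a<h. if a = j div k then X $$ (i div k, a) / k else 0)"
      using cols dm by (intro sum.cong refl) (auto simp flip: sum_distrib_left sum_divide_distrib)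
    also have "\<dots> = (X \<otimes>\<^sub>K uniform_mat k) $$ (i, j)" using dm idx[OF ij] by simp
    finally have "((X \<otimes>\<^sub>K uniform_mat k) * diag_block_mat As) $$ (i, j) = (X \<otimes>\<^sub>K uniform_mat k) $$ (i, j)" .
    note 1 and this
  }
  thus "diag_block_mat As * (X \<otimes>\<^sub>K uniform_mat k) = X \<otimes>\<^sub>K uniform_mat k"
    "(X \<otimes>\<^sub>K uniform_mat k) * diag_block_mat As = X \<otimes>\<^sub>K uniform_mat k"
    using D XU by (auto intro!: eq_matI)
qed

section \<open>Permutation and cyclic shift matrices\<close>

lemma permutation_matrix_mult_transpose:
  fixes P :: "'a :: field mat"
  assumes "permutation_matrix n P"
  shows "P \<in> carrier_mat n n" "P * transpose_mat P = 1\<^sub>m n" "transpose_mat P * P = 1\<^sub>m n"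
proof -
  obtain \<sigma> where \<sigma>: "\<sigma> permutes {..<n}" and P: "P = mat n n (\<lambda>(i, j). if j = \<sigma> i then 1 else 0)"
    using assms by (auto simp: permutation_matrix_def)
  show c: "P \<in> carrier_mat n n" by (simp add: P)
  show PPt: "P * transpose_mat P = 1\<^sub>m n"
  proof (rule eq_matI)
    fix i k assume "i < dim_row (1\<^sub>m n :: 'a mat)" "k < dim_col (1\<^sub>m n :: 'a mat)"
    hence ik: "i < n" "k < n" by auto
    have "(P * transpose_mat P) $$ (i, k) = (\<Sum>j<n. P $$ (i, j) * transpose_mat P $$ (j, k))"
      using c ik by (intro index_mult_mat_sum) auto
    also have "\<dots> = (\<Sum>j<n. if j = \<sigma> i then (if j = \<sigma> k then 1 else 0) else 0)"
      using ik by (intro sum.cong) (auto simp: P)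
    also have "\<dots> = (if \<sigma> i = \<sigma> k then 1 else 0)"
      using permutes_in_image[OF \<sigma>, of i] ik by simp
    also have "\<dots> = (1\<^sub>m n :: 'a mat) $$ (i, k)"
      using ik permutes_inj[OF \<sigma>] by (auto dest: injD)
    finally show "(P * transpose_mat P) $$ (i, k) = (1\<^sub>m n :: 'a mat) $$ (i, k)" .
  qed (use c in auto)
  \<comment> \<open>For square matrices over a field a right inverse is also a left inverse.\<close>
  show "transpose_mat P * P = 1\<^sub>m n"
    using mat_mult_left_right_inverse[OF c _ PPt] c by simp
qed

lemma cyclic_shift_mat_carrier [simp]: "cyclic_shift_mat h \<in> carrier_mat h h"
  by (simp add: cyclic_shift_mat_def)

text \<open>With indices from 0, reduction modulo \<open>h\<close> merges the superdiagonal and the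
  wrap-around entry of the last row into one rule.\<close>

lemma index_cyclic_shift_mat:
  "i < h \<Longrightarrow> j < h \<Longrightarrow> cyclic_shift_mat h $$ (i, j) = (if j = Suc i mod h then 1 else 0)"
  by (cases "Suc i = h") (auto simp: cyclic_shift_mat_def)

text \<open>Each factor moves the column of the 1 one step further modulo \<open>h\<close>; the
  closed form makes the period \<open>h\<close> visible.\<close>

lemma cyclic_shift_mat_pow:
  "cyclic_shift_mat h ^\<^sub>m r = mat h h (\<lambda>(i, j). if j = (i + r) mod h then 1 else 0)"
proof (induction r)
  case 0
  show ?case by (intro eq_matI) (auto simp: cyclic_shift_mat_def)
next
  case (Suc r)
  show ?case
  proof (rule eq_matI)
    fix i j
    assume "i < dim_row (mat h h (\<lambda>(i, j). if j = (i + Suc r) mod h then 1 else 0))"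
      "j < dim_col (mat h h (\<lambda>(i, j). if j = (i + Suc r) mod h then 1 else 0))"
    hence ij: "i < h" "j < h" by auto
    have "(cyclic_shift_mat h ^\<^sub>m Suc r) $$ (i, j) =
        (\<Sum>k<h. (cyclic_shift_mat h ^\<^sub>m r) $$ (i, k) * cyclic_shift_mat h $$ (k, j))"
      unfolding pow_mat.simps using ij by (intro index_mult_mat_sum) auto
    also have "\<dots> = (\<Sum>k<h. if k = (i + r) mod h then (if j = Suc k mod h then 1 else 0) else 0)"
      using ij by (intro sum.cong) (auto simp: Suc index_cyclic_shift_mat)
    also have "\<dots> = (if j = Suc (i + r) mod h then 1 else 0)"
      using ij by (simp add: mod_Suc_eq)
    finally show "(cyclic_shift_mat h ^\<^sub>m Suc r) $$ (i, j) =
        mat h h (\<lambda>(i, j). if j = (i + Suc r) mod h then 1 else 0) $$ (i, j)"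
      using ij by simp
  qed (auto simp: cyclic_shift_mat_def)
qed

lemma cyclic_shift_mat_pow_add_mult: "cyclic_shift_mat h ^\<^sub>m (m * h + r) = cyclic_shift_mat h ^\<^sub>m r"
proof -
  have "(i + (m * h + r)) mod h = (i + r) mod h" for i
    by (metis add.left_commute add.commute mod_mult_self1)
  thus ?thesis by (simp add: cyclic_shift_mat_pow)
qed

text \<open>The eigenvector has the constant value \<open>\<omega> ^ a\<close> on block
  \<open>a\<close>: averaging within a block fixes it, and the shift to the next block multiplies it
  by \<omega>.\<close>

lemma eigenvalue_cyclic_shift_kronecker_uniform:
  assumes "0 < h" "0 < k" and \<omega>: "\<omega> ^ h = 1"
  shows "eigenvalue (map_mat complex_of_real (cyclic_shift_mat h \<otimes>\<^sub>K uniform_mat k)) \<omega>"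
proof -
  let ?M = "cyclic_shift_mat h \<otimes>\<^sub>K uniform_mat k"
  define w where "w = vec (h * k) (\<lambda>i. \<omega> ^ (i div k))"
  have M: "?M \<in> carrier_mat (h * k) (h * k)" by simp
  have "w $ 0 \<noteq> 0\<^sub>v (h * k) $ 0" using assms by (simp add: w_def)
  hence "w \<noteq> 0\<^sub>v (h * k)" by metis
  moreover have "map_mat complex_of_real ?M *\<^sub>v w = \<omega> \<cdot>\<^sub>v w"
  proof (rule eq_vecI)
    fix i assume "i < dim_vec (\<omega> \<cdot>\<^sub>v w)"
    hence i: "i < h * k" by (simp add: w_def)
    hence dm: "i div k < h" "i mod k < k" using \<open>0 < k\<close> by (auto simp: div_less_of_less_mult)
    have "(map_mat complex_of_real ?M *\<^sub>v w) $ i = (\<Sum>l<h * k. of_real (?M $$ (i, l)) * \<omega> ^ (l div k))"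
      using carrier_matD[OF M] i by (auto simp: scalar_prod_def w_def lessThan_atLeast0 intro!: sum.cong)
    also have "\<dots> = (\<Sum>a<h. \<Sum>b<k. (if a = Suc (i div k) mod h then \<omega> ^ a / k else 0))"
      unfolding sum_lessThan_mult
      by (intro sum.cong refl)
        (use i dm in \<open>auto simp: index_kronecker_prod[of _ h h _ k k] block_index_less
            index_cyclic_shift_mat uniform_mat_def\<close>)
    also have "\<dots> = (\<Sum>a<h. if a = Suc (i div k) mod h then \<omega> ^ a else 0)"
      using \<open>0 < k\<close> by (intro sum.cong refl) auto
    also have "\<dots> = \<omega> ^ (Suc (i div k) mod h)" using \<open>0 < h\<close> by simp
    \<comment> \<open>The wrap-around from the last block to block 0 is where
      \<open>\<omega> ^ h = 1\<close> enters.\<close>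
    also have "\<dots> = \<omega> ^ Suc (i div k)"
    proof -
      have "\<omega> ^ Suc (i div k) = (\<omega> ^ h) ^ (Suc (i div k) div h) * \<omega> ^ (Suc (i div k) mod h)"
        unfolding power_mult[symmetric] power_add[symmetric] by simp
      thus ?thesis using \<omega> by simp
    qed
    finally show "(map_mat complex_of_real ?M *\<^sub>v w) $ i = (\<omega> \<cdot>\<^sub>v w) $ i"
      using i by (simp add: w_def)
  qed (use carrier_matD[OF M] in \<open>auto simp: w_def\<close>)
  ultimately show ?thesis unfolding eigenvalue_def eigenvector_def
    using carrier_matD[OF M] by (intro exI[of _ w]) (auto simp: w_def)
qed

section \<open>The limit along a residue class modulo \<open>h\<close>\<close>

theorem theorem4p4:
  fixes n h n' :: nat and D P :: "real mat" and Ds :: "nat \<Rightarrow> real mat"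
  assumes "0 < n"
    and "doubly_stochastic n D"
    and "irreducible_mat n D"
    and "h = peripheral_count (map_mat complex_of_real D)"
    and "n' = n div h"
    and "permutation_matrix n P"
    and "\<forall>i\<in>{1..h}. doubly_stochastic n' (Ds i)"
    and "transpose_mat P * D * P =
           diag_block_mat (map Ds [1..<Suc h]) * (cyclic_shift_mat h \<otimes>\<^sub>K 1\<^sub>m n')"
  shows "\<forall>r\<in>{1..h}.
           mat_tendsto (\<lambda>m. D ^\<^sub>m (m * h + r))
             (P * ((cyclic_shift_mat h ^\<^sub>m r) \<otimes>\<^sub>K uniform_mat n') * transpose_mat P)"
proof
  fix r assume r: "r \<in> {1..h}"
  hence "h > 0" by simp
  let ?K = "cyclic_shift_mat h" and ?U = "uniform_mat n'"
  let ?c = "map_mat complex_of_real"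
  define Bs where "Bs = map Ds [1..<Suc h]"
  define B where "B = diag_block_mat Bs"
  define M where "M = ?K \<otimes>\<^sub>K ?U"
  define L where "L = P * M * transpose_mat P"
  have D: "D \<in> carrier_mat n n" using assms(2) by (simp add: doubly_stochastic_def)
  note P = permutation_matrix_mult_transpose[OF assms(6)]
  have Pt: "transpose_mat P \<in> carrier_mat n n" using P(1) by simp
  have Bs: "length Bs = h" "\<And>A. A \<in> set Bs \<Longrightarrow> doubly_stochastic n' A"
    using assms(7) by (auto simp: Bs_def simp del: upt_Suc)
  have "B \<in> carrier_mat (length Bs * n') (length Bs * n')"
    unfolding B_def by (rule diag_block_mat_uniform_carrier) (use Bs(2) in \<open>auto simp: doubly_stochastic_def\<close>)
  hence B: "B \<in> carrier_mat (h * n') (h * n')" unfolding Bs(1) .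
  define E where "E = transpose_mat P * D * P"
  have EB: "E = B * (?K \<otimes>\<^sub>K 1\<^sub>m n')" unfolding E_def B_def Bs_def by (rule assms(8))
  have E: "E \<in> carrier_mat n n" unfolding E_def using P(1) Pt D by simp
  \<comment> \<open>Comparing row dimensions in the block decomposition shows that the blocks fill
    the matrix exactly.\<close>
  have "dim_row E = dim_row B" unfolding EB by simp
  hence n: "h * n' = n" using carrier_matD[OF B] carrier_matD[OF E] by simp
  hence "n' > 0" using assms(1) by (auto intro: Nat.gr0I)
  note B = B[unfolded n]
  have KU: "X \<otimes>\<^sub>K ?U \<in> carrier_mat n n" if "X \<in> carrier_mat h h" for X
    using kronecker_prod_carrier[OF that uniform_mat_carrier, of n'] n by simp
  have M: "M \<in> carrier_mat n n" unfolding M_def by (rule KU) simp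
  have K1: "?K \<otimes>\<^sub>K 1\<^sub>m n' \<in> carrier_mat n n"
    using kronecker_prod_carrier[OF cyclic_shift_mat_carrier one_carrier_mat, of h n'] n by simp
  have L: "L \<in> carrier_mat n n" using P(1) Pt M by (simp add: L_def)
  have "P * E * transpose_mat P = P * transpose_mat P * D * (P * transpose_mat P)"
    unfolding E_def using P(1) Pt D by (simp add: assoc_mult_mat[of _ n n _ n _ n])
  hence DE: "D = P * E * transpose_mat P" using P(2) D by simp
  have KK: "?K * ?K \<in> carrier_mat h h" by (rule mult_carrier_mat[of _ h h]) simp_all
  have MM: "M * M = (?K * ?K) \<otimes>\<^sub>K ?U"
    unfolding M_def
    using kronecker_prod_mult[OF cyclic_shift_mat_carrier uniform_mat_carrier
        cyclic_shift_mat_carrier uniform_mat_carrier] by (simp add: uniform_mat_idem)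
  \<comment> \<open>The mixed-product rule merges the two Kronecker factors into
    \<open>M * M\<close>, which absorbs \<open>B\<close> from the left.\<close>
  have "E * M = B * ((?K \<otimes>\<^sub>K 1\<^sub>m n') * M)"
    unfolding EB by (rule assoc_mult_mat[OF B K1 M])
  also have "(?K \<otimes>\<^sub>K 1\<^sub>m n') * M = (?K * ?K) \<otimes>\<^sub>K ?U"
    unfolding M_def
    using kronecker_prod_mult[OF cyclic_shift_mat_carrier one_carrier_mat
        cyclic_shift_mat_carrier uniform_mat_carrier] by (simp add: left_mult_one_mat[OF uniform_mat_carrier])
  also have "B * \<dots> = M * M"
    unfolding MM by (rule diag_block_mult_kronecker_uniform(1)[OF Bs KK, folded B_def])
  finally have EM: "E * M = M * M" .
  \<comment> \<open>On this side \<open>M\<close> absorbs \<open>B\<close> first, and the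
    mixed-product rule finishes.\<close>
  have "M * E = M * B * (?K \<otimes>\<^sub>K 1\<^sub>m n')"
    unfolding EB by (rule assoc_mult_mat[OF M B K1, symmetric])
  also have "M * B = M"
    unfolding M_def by (rule diag_block_mult_kronecker_uniform(2)[OF Bs cyclic_shift_mat_carrier, folded B_def])
  also have "M * (?K \<otimes>\<^sub>K 1\<^sub>m n') = M * M"
    unfolding MM unfolding M_def
    using kronecker_prod_mult[OF cyclic_shift_mat_carrier uniform_mat_carrier
        cyclic_shift_mat_carrier one_carrier_mat] by (simp add: right_mult_one_mat[OF uniform_mat_carrier])
  finally have ME: "M * E = M * M" .
  \<comment> \<open>Conjugation by \<open>P\<close> is multiplicative, so the relations between
    \<open>E\<close> and \<open>M\<close> carry over to \<open>D\<close> and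
    \<open>L\<close>.\<close>
  have conj: "(P * X * transpose_mat P) * (P * Y * transpose_mat P) = P * (X * Y) * transpose_mat P"
    if "X \<in> carrier_mat n n" "Y \<in> carrier_mat n n" for X Y
  proof -
    have "(P * X * transpose_mat P) * (P * Y * transpose_mat P)
        = P * X * (transpose_mat P * P) * Y * transpose_mat P"
      using that P(1) Pt by (simp add: assoc_mult_mat[of _ n n _ n _ n])
    also have "\<dots> = P * (X * Y) * transpose_mat P"
      unfolding P(3) using that P(1) Pt by (simp add: assoc_mult_mat[of _ n n _ n _ n])
    finally show ?thesis .
  qed
  have DL: "D * L = L * L" and LD: "L * D = L * L"
    unfolding DE L_def using EM ME E M by (simp_all add: conj)
  have "similar_mat L M"
    by (rule similar_matI[of _ _ P "transpose_mat P" n]) (use L M P Pt L_def in auto)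
  hence cpL: "char_poly (?c L) = char_poly (?c M)"
    using of_real_hom.char_poly_hom[OF L] of_real_hom.char_poly_hom[OF M] char_poly_similar
    by metis
  have cD: "?c D \<in> carrier_mat n n" and cL: "?c L \<in> carrier_mat n n" and cM: "?c M \<in> carrier_mat n n"
    using D L M by auto
  have cDL: "?c D * ?c L = ?c L * ?c L"
    using of_real_hom.mat_hom_mult[OF D L, where 'a = complex]
      of_real_hom.mat_hom_mult[OF L L, where 'a = complex] DL by simp
  \<comment> \<open>Here \<open>S\<close> is the set of all \<open>h\<close>-th roots of unity. It
    has exactly \<open>h\<close> elements, which is the peripheral count of \<open>D\<close>;
    similarity passes these eigenvalues from \<open>M\<close> to \<open>L\<close>.\<close>
  have sr: "spectral_radius (?c D - ?c L) < 1"
  proof (rule spectral_radius_deflate[OF cD cL assms(1) cDL])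
    show "cmod \<mu> \<le> 1" if "eigenvalue (?c D) \<mu>" for \<mu>
      by (rule row_stochastic_eigenvalue_le_1[OF D _ _ that])
        (use assms(2) in \<open>auto simp: doubly_stochastic_def\<close>)
    show "finite {z :: complex. z ^ h = 1}" by (rule finite_roots_unity) (use \<open>h > 0\<close> in simp)
    show "{z :: complex. z ^ h = 1} \<noteq> {}" by (auto intro: exI[of _ 1])
    show "peripheral_count (?c D) \<le> card {z :: complex. z ^ h = 1}"
      using card_roots_unity_eq[OF \<open>h > 0\<close>] assms(4) by simp
    fix \<mu> :: complex assume "\<mu> \<in> {z. z ^ h = 1}"
    hence \<mu>: "\<mu> ^ h = 1" by simp
    have "eigenvalue (?c M) \<mu>"
      unfolding M_def by (rule eigenvalue_cyclic_shift_kronecker_uniform[OF \<open>h > 0\<close> \<open>n' > 0\<close> \<mu>])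
    hence "eigenvalue (?c L) \<mu>"
      using eigenvalue_root_char_poly[OF cL] eigenvalue_root_char_poly[OF cM] cpL by simp
    moreover have "cmod \<mu> = 1" using power_eq_1_iff[OF \<mu>] \<open>h > 0\<close> by simp
    ultimately show "eigenvalue (?c L) \<mu> \<and> cmod \<mu> = 1" by simp
  qed
  have cF: "?c (D - L) = ?c D - ?c L" using D L by (intro eq_matI) auto
  have F: "D - L \<in> carrier_mat n n" by (rule minus_carrier_mat[OF L])
  let ?R = "P * ((?K ^\<^sub>m r) \<otimes>\<^sub>K ?U) * transpose_mat P"
  have R: "?R \<in> carrier_mat n n"
    using P(1) Pt KU[OF pow_carrier_mat[OF cyclic_shift_mat_carrier], of r] by simp
  have Lpow: "L ^\<^sub>m m = P * M ^\<^sub>m m * transpose_mat P" for m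
  proof (induction m)
    case 0
    show ?case using P Pt M L by simp
  next
    case (Suc m)
    then show ?case using conj[OF pow_carrier_mat[OF M, of m] M] by (simp add: L_def)
  qed
  \<comment> \<open>Since \<open>r\<close> is at least 1, the exponent is positive even for
    \<open>m = 0\<close>, as the power rule for \<open>M\<close> requires; the multiple of
    \<open>h\<close> then drops out by periodicity.\<close>
  have LR: "L ^\<^sub>m (m * h + r) = ?R" for m
    using kronecker_prod_pow[OF cyclic_shift_mat_carrier uniform_mat_carrier uniform_mat_idem,
        of "m * h + r" h n'] r
    unfolding Lpow by (simp add: M_def cyclic_shift_mat_pow_add_mult)
  have Dpow: "D ^\<^sub>m (m * h + r) = (D - L) ^\<^sub>m (m * h + r) + ?R" for m
    using pow_mat_deflate[OF D L DL LD, of "m * h + r"] r LR[of m] by simp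
  have lim: "(\<lambda>m. (D ^\<^sub>m (m * h + r)) $$ (i, j)) \<longlonglongrightarrow> ?R $$ (i, j)" if "i < n" "j < n" for i j
  proof -
    have cFpow: "(?c D - ?c L) ^\<^sub>m m = ?c ((D - L) ^\<^sub>m m)" for m
      using of_real_hom.mat_hom_pow[OF F, of m, where 'a = complex] cF by simp
    have idx: "?c ((D - L) ^\<^sub>m m) $$ (i, j) = of_real (((D - L) ^\<^sub>m m) $$ (i, j))" for m
      by (rule index_map_mat(1)) (simp_all only: carrier_matD[OF pow_carrier_mat[OF F]] that)
    have FD: "?c D - ?c L \<in> carrier_mat n n" by (rule minus_carrier_mat[OF cL])
    \<comment> \<open>The spectral bound is complex, but the entries of the powers are images of
      real numbers, so the limit descends to the reals.\<close>
    have "(\<lambda>m. complex_of_real (((D - L) ^\<^sub>m m) $$ (i, j))) \<longlonglongrightarrow> of_real 0"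
      using pow_mat_entry_tendsto_0[OF FD assms(1) sr that] unfolding cFpow idx by simp
    hence "(\<lambda>m. ((D - L) ^\<^sub>m m) $$ (i, j)) \<longlonglongrightarrow> 0"
      by (simp only: tendsto_of_real_iff)
    \<comment> \<open>As \<open>h\<close> is positive, the exponents \<open>m * h + r\<close>
      increase strictly, so the decay passes to this subsequence.\<close>
    moreover have "filterlim (\<lambda>m. m * h + r) sequentially sequentially"
      by (rule filterlim_subseq) (use \<open>h > 0\<close> in \<open>auto simp: strict_mono_def\<close>)
    ultimately have "(\<lambda>m. ((D - L) ^\<^sub>m (m * h + r)) $$ (i, j)) \<longlonglongrightarrow> 0"
      by (rule filterlim_compose)
    hence "(\<lambda>m. ((D - L) ^\<^sub>m (m * h + r)) $$ (i, j) + ?R $$ (i, j)) \<longlonglongrightarrow> 0 + ?R $$ (i, j)"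
      by (intro tendsto_add tendsto_const)
    moreover have "(D ^\<^sub>m (m * h + r)) $$ (i, j) = ((D - L) ^\<^sub>m (m * h + r)) $$ (i, j) + ?R $$ (i, j)" for m
      unfolding Dpow by (rule index_add_mat(1)) (simp_all only: carrier_matD[OF R] that)
    ultimately show ?thesis by simp
  qed
  show "mat_tendsto (\<lambda>m. D ^\<^sub>m (m * h + r)) ?R"
    unfolding mat_tendsto_def carrier_matD[OF R] using D lim by simp
qed

end
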